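(* Let $(M,g,\nabla,\nabla^{*})$ be a statistical manifold, with $\nabla=\nabla^{g}+K$ and $\nabla^{*}=\nabla^{g}-K$, where $\nabla^{g}$ is the Levi-Civita connection of $g$ and $K$ is the statistical difference tensor. A $(1,1)$-tensor field $\Theta$ on $M$ satisfies the gauge equation \[ \nabla_X(\Theta Y)=\Theta(\nabla_X^{*}Y)\qquad\text{for all }X,Y\in\Gamma(TM) \] if and only if \[ (\nabla_X^{g}\Theta)Y+K_X(\Theta Y)+\Theta K_XY=0\qquad\text{for all }X,Y\in\Gamma(TM). \] In particular, if $\nabla^{g}\Theta=0$, then the gauge equation is equivalent to \[ K_X\Theta=-\Theta K_X \] for every $X\in\Gamma(TM)$.
   Context: A statistical manifold $(M,g,\nabla,\nabla^{*})$ is a Riemannian manifold $(M,g)$ with two torsion-free affine connections $\nabla,\nabla^{*}$ that are dual with respect to $g$: $Xg(Y,Z)=g(\nabla_XY,Z)+g(Y,\nabla_X^{*}Z)$ for all vector fields $X,Y,Z$. The Levi-Civita connection $\nabla^g$ is the midpoint of $\nabla$ and $\nabla^*$, and the statistical difference tensor $K=\nabla-\nabla^{g}$ satisfies $K_XY=K_YX$ and $g(K_XY,Z)=g(Y,K_XZ)$. Here $K_X$ denotes the endomorphism $Y\mapsto K_XY$ of $TM$. *)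

theory Defs
  imports "HOL-Analysis.Analysis" "HOL-Library.Function_Algebras"
begin

text \<open>
  Smooth means \<open>C\<^sup>\<infinity>\<close>. Function spaces (smooth functions, tangent vectors, vector fields)
  carry the pointwise operations of \<^theory>\<open>HOL-Library.Function_Algebras\<close>.
\<close>

subsection \<open>Smooth manifolds\<close>

text \<open>Meant for open \<open>S\<close> and finite-dimensional domain, where continuity of all iterated
  directional derivatives up to order \<open>k\<close> is continuous differentiability of order \<open>k\<close>.\<close>

primrec Ck_on :: "nat \<Rightarrow> 'a::real_normed_vector set \<Rightarrow> ('a \<Rightarrow> 'b::real_normed_vector) \<Rightarrow> bool" where
  "Ck_on 0 S f \<longleftrightarrow> continuous_on S f"
| "Ck_on (Suc k) S f \<longleftrightarrow> (\<forall>x\<in>S. f differentiable (at x)) \<and>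
     (\<forall>v. Ck_on k S (\<lambda>x. frechet_derivative f (at x) v))"

definition smooth_on :: "'a::real_normed_vector set \<Rightarrow> ('a \<Rightarrow> 'b::real_normed_vector) \<Rightarrow> bool" where
  "smooth_on S f \<longleftrightarrow> (\<forall>k. Ck_on k S f)"

text \<open>A chart is a pair of a domain and a coordinate map; coordinates outside the domain are
  irrelevant.\<close>

type_synonym ('a, 'b) chart = "'a set \<times> ('a \<Rightarrow> 'b)"

definition is_chart :: "('a::topological_space, 'b::euclidean_space) chart \<Rightarrow> bool" where
  "is_chart c \<longleftrightarrow> (case c of (U, \<phi>) \<Rightarrow>
     open U \<and> open (\<phi> ` U) \<and> homeomorphism U (\<phi> ` U) \<phi> (inv_into U \<phi>))"

definition smoothly_compatible ::
  "('a::topological_space, 'b::euclidean_space) chart \<Rightarrow> ('a, 'b) chart \<Rightarrow> bool" where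
  "smoothly_compatible c d \<longleftrightarrow> (case c of (U, \<phi>) \<Rightarrow> case d of (V, \<psi>) \<Rightarrow>
     smooth_on (\<phi> ` (U \<inter> V)) (\<psi> \<circ> inv_into U \<phi>) \<and>
     smooth_on (\<psi> ` (U \<inter> V)) (\<phi> \<circ> inv_into V \<psi>))"

text \<open>The manifold is the whole type \<open>'a\<close>, of dimension \<open>DIM('b)\<close>. The atlas need not be
  maximal: everything below depends only on the smooth structure it generates.\<close>

definition smooth_manifold ::
  "('a::{t2_space,second_countable_topology}, 'b::euclidean_space) chart set \<Rightarrow> bool" where
  "smooth_manifold A \<longleftrightarrow> (\<forall>c\<in>A. is_chart c) \<and> (\<Union>(fst ` A) = UNIV) \<and>
     (\<forall>c\<in>A. \<forall>d\<in>A. smoothly_compatible c d)"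

definition smooth_functions ::
  "('a::topological_space, 'b::euclidean_space) chart set \<Rightarrow> ('a \<Rightarrow> real) set" where
  "smooth_functions A = {f. \<forall>(U, \<phi>)\<in>A. smooth_on (\<phi> ` U) (f \<circ> inv_into U \<phi>)}"

subsection \<open>Tangent vectors and vector fields\<close>

type_synonym 'a tvec = "('a \<Rightarrow> real) \<Rightarrow> real"
type_synonym 'a vfield = "'a \<Rightarrow> 'a tvec"

text \<open>Tangent vectors at \<open>p\<close> are the derivations at \<open>p\<close> of the algebra of smooth functions;
  the last clause fixes the irrelevant values on non-smooth functions, so that equality of
  tangent vectors is equality in HOL.\<close>

definition tangent_space ::
  "('a::topological_space, 'b::euclidean_space) chart set \<Rightarrow> 'a \<Rightarrow> 'a tvec set" where
  "tangent_space A p = {v.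
     (\<forall>f\<in>smooth_functions A. \<forall>h\<in>smooth_functions A. v (\<lambda>q. f q + h q) = v f + v h) \<and>
     (\<forall>c. \<forall>f\<in>smooth_functions A. v (\<lambda>q. c * f q) = c * v f) \<and>
     (\<forall>f\<in>smooth_functions A. \<forall>h\<in>smooth_functions A.
        v (\<lambda>q. f q * h q) = f p * v h + h p * v f) \<and>
     (\<forall>f. f \<notin> smooth_functions A \<longrightarrow> v f = 0)}"

definition tscale :: "real \<Rightarrow> 'a tvec \<Rightarrow> 'a tvec" where
  "tscale c v = (\<lambda>f. c * v f)"

definition vf_apply :: "'a vfield \<Rightarrow> ('a \<Rightarrow> real) \<Rightarrow> 'a \<Rightarrow> real" where
  "vf_apply X f = (\<lambda>p. X p f)"

definition vf_scale :: "('a \<Rightarrow> real) \<Rightarrow> 'a vfield \<Rightarrow> 'a vfield" where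
  "vf_scale f X = (\<lambda>p. tscale (f p) (X p))"

text \<open>The space \<open>\<Gamma>(TM)\<close> of smooth vector fields.\<close>

definition vector_fields ::
  "('a::topological_space, 'b::euclidean_space) chart set \<Rightarrow> 'a vfield set" where
  "vector_fields A = {X. (\<forall>p. X p \<in> tangent_space A p) \<and>
     (\<forall>f\<in>smooth_functions A. vf_apply X f \<in> smooth_functions A)}"

definition lie_bracket :: "'a vfield \<Rightarrow> 'a vfield \<Rightarrow> 'a vfield" where
  "lie_bracket X Y = (\<lambda>p f. X p (vf_apply Y f) - Y p (vf_apply X f))"

subsection \<open>Riemannian metrics\<close>

type_synonym 'a metric_field = "'a \<Rightarrow> 'a tvec \<Rightarrow> 'a tvec \<Rightarrow> real"

definition metric_apply :: "'a metric_field \<Rightarrow> 'a vfield \<Rightarrow> 'a vfield \<Rightarrow> 'a \<Rightarrow> real" where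
  "metric_apply g X Y = (\<lambda>p. g p (X p) (Y p))"

definition riemannian_metric ::
  "('a::topological_space, 'b::euclidean_space) chart set \<Rightarrow> 'a metric_field \<Rightarrow> bool" where
  "riemannian_metric A g \<longleftrightarrow>
     (\<forall>p. \<forall>u\<in>tangent_space A p. \<forall>v\<in>tangent_space A p. g p u v = g p v u) \<and>
     (\<forall>p. \<forall>u\<in>tangent_space A p. \<forall>v\<in>tangent_space A p. \<forall>w\<in>tangent_space A p.
        g p (u + v) w = g p u w + g p v w) \<and>
     (\<forall>p c. \<forall>u\<in>tangent_space A p. \<forall>v\<in>tangent_space A p. g p (tscale c u) v = c * g p u v) \<and>
     (\<forall>p. \<forall>u\<in>tangent_space A p. u \<noteq> 0 \<longrightarrow> g p u u > 0) \<and>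
     (\<forall>X\<in>vector_fields A. \<forall>Y\<in>vector_fields A. metric_apply g X Y \<in> smooth_functions A)"

definition riemannian_manifold ::
  "('a::{t2_space,second_countable_topology}, 'b::euclidean_space) chart set \<Rightarrow>
     'a metric_field \<Rightarrow> bool" where
  "riemannian_manifold A g \<longleftrightarrow> smooth_manifold A \<and> riemannian_metric A g"

subsection \<open>Affine connections\<close>

text \<open>\<open>D X Y\<close> is \<open>\<nabla>\<^sub>X Y\<close>. Homogeneity over the reals in \<open>Y\<close> is the Leibniz rule for constant
  functions.\<close>

type_synonym 'a conn = "'a vfield \<Rightarrow> 'a vfield \<Rightarrow> 'a vfield"

definition affine_connection ::
  "('a::topological_space, 'b::euclidean_space) chart set \<Rightarrow> 'a conn \<Rightarrow> bool" where
  "affine_connection A D \<longleftrightarrow>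
     (\<forall>X\<in>vector_fields A. \<forall>Y\<in>vector_fields A. D X Y \<in> vector_fields A) \<and>
     (\<forall>X\<in>vector_fields A. \<forall>X'\<in>vector_fields A. \<forall>Y\<in>vector_fields A.
        D (X + X') Y = D X Y + D X' Y) \<and>
     (\<forall>f\<in>smooth_functions A. \<forall>X\<in>vector_fields A. \<forall>Y\<in>vector_fields A.
        D (vf_scale f X) Y = vf_scale f (D X Y)) \<and>
     (\<forall>X\<in>vector_fields A. \<forall>Y\<in>vector_fields A. \<forall>Y'\<in>vector_fields A.
        D X (Y + Y') = D X Y + D X Y') \<and>
     (\<forall>f\<in>smooth_functions A. \<forall>X\<in>vector_fields A. \<forall>Y\<in>vector_fields A.
        D X (vf_scale f Y) = vf_scale (vf_apply X f) Y + vf_scale f (D X Y))"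

definition torsion_free ::
  "('a::topological_space, 'b::euclidean_space) chart set \<Rightarrow> 'a conn \<Rightarrow> bool" where
  "torsion_free A D \<longleftrightarrow>
     (\<forall>X\<in>vector_fields A. \<forall>Y\<in>vector_fields A. D X Y - D Y X = lie_bracket X Y)"

definition dual_connections ::
  "('a::topological_space, 'b::euclidean_space) chart set \<Rightarrow> 'a metric_field \<Rightarrow>
     'a conn \<Rightarrow> 'a conn \<Rightarrow> bool" where
  "dual_connections A g D D' \<longleftrightarrow>
     (\<forall>X\<in>vector_fields A. \<forall>Y\<in>vector_fields A. \<forall>Z\<in>vector_fields A. \<forall>p.
        vf_apply X (metric_apply g Y Z) p
          = metric_apply g (D X Y) Z p + metric_apply g Y (D' X Z) p)"

text \<open>Compatibility of a connection with \<open>g\<close> is self-duality.\<close>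

definition levi_civita_connection ::
  "('a::topological_space, 'b::euclidean_space) chart set \<Rightarrow> 'a metric_field \<Rightarrow> 'a conn \<Rightarrow> bool" where
  "levi_civita_connection A g D \<longleftrightarrow>
     affine_connection A D \<and> torsion_free A D \<and> dual_connections A g D D"

definition statistical_manifold ::
  "('a::{t2_space,second_countable_topology}, 'b::euclidean_space) chart set \<Rightarrow>
     'a metric_field \<Rightarrow> 'a conn \<Rightarrow> 'a conn \<Rightarrow> bool" where
  "statistical_manifold A g D D' \<longleftrightarrow> riemannian_manifold A g \<and>
     affine_connection A D \<and> torsion_free A D \<and>
     affine_connection A D' \<and> torsion_free A D' \<and>
     dual_connections A g D D'"

text \<open>With \<open>Dg\<close> the Levi-Civita connection this is \<open>K = \<nabla> - \<nabla>\<^sup>g\<close>; \<open>difference_tensor D Dg X\<close> is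
  the endomorphism \<open>K\<^sub>X\<close>, acting on \<open>\<Gamma>(TM)\<close>.\<close>

definition difference_tensor :: "'a conn \<Rightarrow> 'a conn \<Rightarrow> 'a vfield \<Rightarrow> 'a vfield \<Rightarrow> 'a vfield" where
  "difference_tensor D Dg X Y = D X Y - Dg X Y"

subsection \<open>Tensor fields of type (1,1) and the gauge equation\<close>

type_synonym 'a endo_field = "'a \<Rightarrow> 'a tvec \<Rightarrow> 'a tvec"

definition endo_apply :: "'a endo_field \<Rightarrow> 'a vfield \<Rightarrow> 'a vfield" where
  "endo_apply \<Theta> Y = (\<lambda>p. \<Theta> p (Y p))"

text \<open>Smooth fields of linear endomorphisms of the tangent spaces.\<close>

definition tensor_field_11 ::
  "('a::topological_space, 'b::euclidean_space) chart set \<Rightarrow> 'a endo_field \<Rightarrow> bool" where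
  "tensor_field_11 A \<Theta> \<longleftrightarrow>
     (\<forall>p. \<forall>u\<in>tangent_space A p. \<Theta> p u \<in> tangent_space A p) \<and>
     (\<forall>p. \<forall>u\<in>tangent_space A p. \<forall>v\<in>tangent_space A p. \<Theta> p (u + v) = \<Theta> p u + \<Theta> p v) \<and>
     (\<forall>p c. \<forall>u\<in>tangent_space A p. \<Theta> p (tscale c u) = tscale c (\<Theta> p u)) \<and>
     (\<forall>Y\<in>vector_fields A. endo_apply \<Theta> Y \<in> vector_fields A)"

text \<open>\<open>(\<nabla>\<^sub>X \<Theta>) Y\<close>\<close>

definition cov_deriv_endo :: "'a conn \<Rightarrow> 'a endo_field \<Rightarrow> 'a vfield \<Rightarrow> 'a vfield \<Rightarrow> 'a vfield" where
  "cov_deriv_endo D \<Theta> X Y = D X (endo_apply \<Theta> Y) - endo_apply \<Theta> (D X Y)"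

definition gauge_equation ::
  "('a::topological_space, 'b::euclidean_space) chart set \<Rightarrow> 'a conn \<Rightarrow> 'a conn \<Rightarrow>
     'a endo_field \<Rightarrow> bool" where
  "gauge_equation A D D' \<Theta> \<longleftrightarrow> (\<forall>X\<in>vector_fields A. \<forall>Y\<in>vector_fields A.
     D X (endo_apply \<Theta> Y) = endo_apply \<Theta> (D' X Y))"

end

theory Submission
  imports Defs
begin

text \<open>
  Both claims are algebra once \<open>\<nabla>\<^sup>* = \<nabla>\<^sup>g - K\<close> is known: then
  \<open>(\<nabla>\<^sup>g\<^sub>X \<Theta>) Y + K\<^sub>X (\<Theta> Y) + \<Theta> (K\<^sub>X Y) = \<nabla>\<^sub>X (\<Theta> Y) - \<Theta> (\<nabla>\<^sup>*\<^sub>X Y)\<close>,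
  so that the left-hand side is exactly the defect of the gauge equation
  (\<open>cov_deriv_endo_plus_difference_tensor\<close>), and for parallel \<open>\<Theta>\<close> its first term drops out.

  The geometric content is that the Levi-Civita connection is the midpoint of two dual
  torsion-free connections (\<open>levi_civita_is_midpoint\<close>). Let
  \<open>T(X,Y) = \<nabla>\<^sub>X Y + \<nabla>\<^sup>*\<^sub>X Y - 2 \<nabla>\<^sup>g\<^sub>X Y\<close>. Since all three connections have torsion zero, \<open>T\<close> is
  symmetric. Duality, applied to \<open>(X,Y,Z)\<close> and to \<open>(X,Z,Y)\<close>, together with compatibility of
  \<open>\<nabla>\<^sup>g\<close> with \<open>g\<close>, shows that \<open>g(T(X,Y),Z)\<close> is skew in \<open>Y\<close> and \<open>Z\<close>. A trilinear form which is
  symmetric in one pair of neighbouring arguments and skew in the other vanishes, and \<open>T = 0\<close>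
  follows because \<open>g\<close> is positive definite.
\<close>

section \<open>Linear algebra in the tangent spaces\<close>

text \<open>Stated for vector fields only: as a rewrite rule for arbitrary functions it would go on to
  split differences of tangent vectors, which are functions themselves.\<close>

lemma vfield_diff_apply: "(X - Y) p = X p - Y p" for X Y :: "'a vfield"
  by simp

lemma tscale_minus_one: "u + tscale (-1) v = u - v"
  by (simp add: fun_eq_iff tscale_def)

lemma tangent_space_add:
  assumes "u \<in> tangent_space A p" and "v \<in> tangent_space A p"
  shows "u + v \<in> tangent_space A p"
  using assms by (simp add: tangent_space_def algebra_simps)

lemma tangent_space_tscale:
  assumes "u \<in> tangent_space A p"
  shows "tscale c u \<in> tangent_space A p"
  using assms by (simp add: tangent_space_def tscale_def algebra_simps)

lemma tangent_space_diff:
  assumes "u \<in> tangent_space A p" and "v \<in> tangent_space A p"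
  shows "u - v \<in> tangent_space A p"
  using tangent_space_add[OF assms(1) tangent_space_tscale[OF assms(2), of "-1"]]
  by (simp only: tscale_minus_one)

lemma vector_fields_tangent: "X \<in> vector_fields A \<Longrightarrow> X p \<in> tangent_space A p"
  by (simp add: vector_fields_def)

lemma metric_diff_left:
  assumes g: "riemannian_metric A g"
    and u: "u \<in> tangent_space A p" and v: "v \<in> tangent_space A p" and w: "w \<in> tangent_space A p"
  shows "g p (u - v) w = g p u w - g p v w"
proof -
  have "g p (u + tscale (-1) v) w = g p u w + g p (tscale (-1) v) w"
    using g u tangent_space_tscale[OF v] w by (simp add: riemannian_metric_def)
  also have "g p (tscale (-1) v) w = (-1) * g p v w"
    using g v w unfolding riemannian_metric_def by blast
  finally show ?thesis
    by (simp only: tscale_minus_one mult_minus1 add_uminus_conv_diff)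
qed

lemma metric_commute:
  assumes "riemannian_metric A g" and "u \<in> tangent_space A p" and "v \<in> tangent_space A p"
  shows "g p u v = g p v u"
  using assms by (simp add: riemannian_metric_def)

lemma metric_diff_right:
  assumes "riemannian_metric A g"
    and "u \<in> tangent_space A p" and "v \<in> tangent_space A p" and "w \<in> tangent_space A p"
  shows "g p w (u - v) = g p w u - g p w v"
  using assms metric_diff_left[OF assms] metric_commute[OF assms(1)] tangent_space_diff
  by metis

lemma metric_definite:
  assumes "riemannian_metric A g" and "u \<in> tangent_space A p" and "g p u u = 0"
  shows "u = 0"
  using assms unfolding riemannian_metric_def by (metis less_irrefl)

lemma endo_field_diff:
  assumes \<Theta>: "tensor_field_11 A \<Theta>"
    and u: "u \<in> tangent_space A p" and v: "v \<in> tangent_space A p"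
  shows "\<Theta> p (u - v) = \<Theta> p u - \<Theta> p v"
proof -
  have "\<Theta> p (u + tscale (-1) v) = \<Theta> p u + \<Theta> p (tscale (-1) v)"
    using \<Theta> u tangent_space_tscale[OF v] by (simp add: tensor_field_11_def)
  also have "\<Theta> p (tscale (-1) v) = tscale (-1) (\<Theta> p v)"
    using \<Theta> v by (simp add: tensor_field_11_def)
  finally show ?thesis
    by (simp only: tscale_minus_one)
qed

section \<open>The Levi-Civita connection as a midpoint\<close>

text \<open>The product of the two swaps, of the first two and of the last two arguments, is a
  3-cycle. Applying it three times restores the order of the arguments but changes the sign
  three times, so each value is its own negative.\<close>

lemma symmetric_skew_zero:
  fixes c :: "'v \<Rightarrow> 'v \<Rightarrow> 'v \<Rightarrow> real"
  assumes sym: "\<And>x y z. x \<in> V \<Longrightarrow> y \<in> V \<Longrightarrow> z \<in> V \<Longrightarrow> c x y z = c y x z"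
    and skew: "\<And>x y z. x \<in> V \<Longrightarrow> y \<in> V \<Longrightarrow> z \<in> V \<Longrightarrow> c x y z = - c x z y"
    and "x \<in> V" "y \<in> V" "z \<in> V"
  shows "c x y z = 0"
proof -
  have "c x y z = c y x z" by (intro sym assms)
  also have "\<dots> = - c y z x" by (intro skew assms)
  also have "c y z x = c z y x" by (intro sym assms)
  also have "\<dots> = - c z x y" by (intro skew assms)
  also have "c z x y = c x z y" by (intro sym assms)
  also have "\<dots> = - c x y z" by (intro skew assms)
  finally show ?thesis by simp
qed

text \<open>The midpoint property in the form in which it is used: the two tensors
  \<open>\<nabla> - \<nabla>\<^sup>g\<close> and \<open>\<nabla>\<^sup>g - \<nabla>\<^sup>*\<close> agree. Positive definiteness asks for their difference
  \<open>T(X,Y)\<close> as last argument of \<open>g(T(X,Y), -)\<close>, while symmetry and skewness concern vector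
  fields. Proving that the linear combination \<open>T(X,Y)\<close> is smooth can be avoided: it is enough to
  insert each of \<open>\<nabla>\<^sub>X Y\<close>, \<open>\<nabla>\<^sup>*\<^sub>X Y\<close> and
  \<open>\<nabla>\<^sup>g\<^sub>X Y\<close>, which are vector fields, and to combine the results in the tangent space.\<close>

lemma levi_civita_is_midpoint:
  assumes stat: "statistical_manifold A g D D'"
    and lc: "levi_civita_connection A g Dg"
    and X: "X \<in> vector_fields A" and Y: "Y \<in> vector_fields A"
  shows "difference_tensor D Dg X Y = difference_tensor Dg D' X Y"
proof
  fix p
  let ?V = "vector_fields A"
  define T where
    "T X Y = difference_tensor D Dg X Y p - difference_tensor Dg D' X Y p" for X Y
  have g: "riemannian_metric A g"
    using stat by (simp add: statistical_manifold_def riemannian_manifold_def)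
  have closed: "D X Y \<in> ?V" "D' X Y \<in> ?V" "Dg X Y \<in> ?V" if "X \<in> ?V" "Y \<in> ?V" for X Y
    using stat lc that
    by (simp_all add: statistical_manifold_def levi_civita_connection_def affine_connection_def)
  note tangent = closed[THEN vector_fields_tangent] vector_fields_tangent tangent_space_diff
  have T_tangent: "T X Y \<in> tangent_space A p" if "X \<in> ?V" "Y \<in> ?V" for X Y
    unfolding T_def difference_tensor_def vfield_diff_apply using that by (intro tangent)
  have g_T: "g p (T X Y) w = g p (D X Y p) w + g p (D' X Y p) w - 2 * g p (Dg X Y p) w"
    if "X \<in> ?V" "Y \<in> ?V" "w \<in> tangent_space A p" for X Y w
    unfolding T_def difference_tensor_def vfield_diff_apply
    using that by (simp only: metric_diff_left[OF g] tangent)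
  have T_sym: "T X Y = T Y X" if "X \<in> ?V" "Y \<in> ?V" for X Y
  proof -
    have "D X Y - D Y X = lie_bracket X Y" "D' X Y - D' Y X = lie_bracket X Y"
      "Dg X Y - Dg Y X = lie_bracket X Y"
      using stat lc that
      by (simp_all add: statistical_manifold_def levi_civita_connection_def torsion_free_def)
    then have "D X Y = lie_bracket X Y + D Y X" "D' X Y = lie_bracket X Y + D' Y X"
      "Dg X Y = lie_bracket X Y + Dg Y X"
      by (metis diff_add_cancel)+
    then show ?thesis
      by (simp add: T_def difference_tensor_def)
  qed
  have T_skew: "g p (T X Y) (Z p) = - g p (T X Z) (Y p)" if V: "X \<in> ?V" "Y \<in> ?V" "Z \<in> ?V" for X Y Z
  proof -
    have metric_sym: "metric_apply g Z Y = metric_apply g Y Z"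
      using V metric_commute[OF g] by (simp add: fun_eq_iff metric_apply_def tangent)
    have comm: "g p (Y p) (D' X Z p) = g p (D' X Z p) (Y p)"
      "g p (Z p) (D' X Y p) = g p (D' X Y p) (Z p)"
      "g p (Y p) (Dg X Z p) = g p (Dg X Z p) (Y p)"
      by (intro metric_commute[OF g] tangent V)+
    have dual: "dual_connections A g D D'" "dual_connections A g Dg Dg"
      using stat lc by (simp_all add: statistical_manifold_def levi_civita_connection_def)
    let ?d = "vf_apply X (metric_apply g Y Z) p"
    have "?d = g p (D X Y p) (Z p) + g p (D' X Z p) (Y p)"
      using dual(1) V by (simp add: dual_connections_def metric_apply_def comm)
    moreover have "?d = g p (D X Z p) (Y p) + g p (D' X Y p) (Z p)"
      using dual(1) V unfolding metric_sym[symmetric]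
      by (simp add: dual_connections_def metric_apply_def comm)
    moreover have "?d = g p (Dg X Y p) (Z p) + g p (Dg X Z p) (Y p)"
      using dual(2) V by (simp add: dual_connections_def metric_apply_def comm)
    ultimately show ?thesis
      using V by (simp add: g_T tangent)
  qed
  have vanish: "g p (T X Y) (Z p) = 0" if "Z \<in> ?V" for Z
  proof (rule symmetric_skew_zero[where c = "\<lambda>X Y Z. g p (T X Y) (Z p)" and V = ?V])
    show "g p (T X Y) (Z p) = g p (T Y X) (Z p)" if "X \<in> ?V" "Y \<in> ?V" for X Y Z
      by (simp only: T_sym[OF that])
  qed (fact X Y that T_skew)+
  have "g p (Z p) (T X Y) = 0" if "Z \<in> ?V" for Z
    using vanish[OF that] metric_commute[OF g vector_fields_tangent[OF that] T_tangent[OF X Y]] by simp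
  from this[OF closed(1)[OF X Y]] this[OF closed(2)[OF X Y]] this[OF closed(3)[OF X Y]]
  have "g p (T X Y) (T X Y) = 0"
    by (simp only: g_T[OF X Y T_tangent[OF X Y]])
  then have "T X Y = 0"
    by (rule metric_definite[OF g T_tangent[OF X Y]])
  then show "difference_tensor D Dg X Y p = difference_tensor Dg D' X Y p"
    by (simp add: T_def)
qed

section \<open>The gauge equation\<close>

text \<open>Cancelling \<open>\<nabla>\<^sup>g\<^sub>X (\<Theta> Y)\<close> leaves \<open>\<nabla>\<^sub>X (\<Theta> Y) - \<Theta> (\<nabla>\<^sup>g\<^sub>X Y - K\<^sub>X Y)\<close>, and
  \<open>\<nabla>\<^sup>g - K = \<nabla>\<^sup>*\<close> by the midpoint property.\<close>

lemma cov_deriv_endo_plus_difference_tensor: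
  fixes A :: "('a::{t2_space,second_countable_topology}, 'b::euclidean_space) chart set"
  assumes stat: "statistical_manifold A g D D'"
    and lc: "levi_civita_connection A g Dg"
    and \<Theta>: "tensor_field_11 A \<Theta>"
    and X: "X \<in> vector_fields A" and Y: "Y \<in> vector_fields A"
  shows "cov_deriv_endo Dg \<Theta> X Y + difference_tensor D Dg X (endo_apply \<Theta> Y)
           + endo_apply \<Theta> (difference_tensor D Dg X Y)
         = D X (endo_apply \<Theta> Y) - endo_apply \<Theta> (D' X Y)"
proof -
  have "D' X Y \<in> vector_fields A" "Dg X Y \<in> vector_fields A"
    using stat lc X Y
    by (simp_all add: statistical_manifold_def levi_civita_connection_def affine_connection_def)
  then have "endo_apply \<Theta> (Dg X Y - D' X Y) = endo_apply \<Theta> (Dg X Y) - endo_apply \<Theta> (D' X Y)"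
    by (intro ext[where 'a = 'a])
      (simp only: endo_apply_def vfield_diff_apply endo_field_diff[OF \<Theta>] vector_fields_tangent)
  moreover have "difference_tensor D Dg X Y = Dg X Y - D' X Y"
    using levi_civita_is_midpoint[OF stat lc X Y] by (simp only: difference_tensor_def[of Dg])
  ultimately show ?thesis
    by (simp add: cov_deriv_endo_def difference_tensor_def[of D Dg X "endo_apply \<Theta> Y"])
qed

theorem proposition2p5:
  fixes A :: "('a::{t2_space,second_countable_topology}, 'b::euclidean_space) chart set"
    and g :: "'a metric_field"
    and D D' Dg :: "'a conn"
    and K :: "'a vfield \<Rightarrow> 'a vfield \<Rightarrow> 'a vfield"
    and \<Theta> :: "'a endo_field"
  assumes "statistical_manifold A g D D'"
    and "levi_civita_connection A g Dg"
    and "K = difference_tensor D Dg"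
    and "tensor_field_11 A \<Theta>"
  shows "(gauge_equation A D D' \<Theta> \<longleftrightarrow>
           (\<forall>X\<in>vector_fields A. \<forall>Y\<in>vector_fields A.
              cov_deriv_endo Dg \<Theta> X Y + K X (endo_apply \<Theta> Y) + endo_apply \<Theta> (K X Y) = 0)) \<and>
         ((\<forall>X\<in>vector_fields A. \<forall>Y\<in>vector_fields A. cov_deriv_endo Dg \<Theta> X Y = 0) \<longrightarrow>
           (gauge_equation A D D' \<Theta> \<longleftrightarrow>
             (\<forall>X\<in>vector_fields A. \<forall>Y\<in>vector_fields A.
                K X (endo_apply \<Theta> Y) = - endo_apply \<Theta> (K X Y))))"
proof -
  have defect: "cov_deriv_endo Dg \<Theta> X Y + K X (endo_apply \<Theta> Y) + endo_apply \<Theta> (K X Y)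
      = D X (endo_apply \<Theta> Y) - endo_apply \<Theta> (D' X Y)"
    if "X \<in> vector_fields A" "Y \<in> vector_fields A" for X Y
    unfolding assms(3)
    by (rule cov_deriv_endo_plus_difference_tensor[OF assms(1,2,4) that])
  have gauge_iff: "gauge_equation A D D' \<Theta> \<longleftrightarrow>
      (\<forall>X\<in>vector_fields A. \<forall>Y\<in>vector_fields A.
         cov_deriv_endo Dg \<Theta> X Y + K X (endo_apply \<Theta> Y) + endo_apply \<Theta> (K X Y) = 0)"
    by (simp add: gauge_equation_def defect)
  show ?thesis
    unfolding gauge_iff by (simp add: eq_neg_iff_add_eq_0)
qed

end
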